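(* Let $A\in\mathbb{R}^{m\times n}$, $y\in\mathbb{R}^m$, $\lambda>0$, and let $f=\tfrac12\|y-\cdot\|_2^2$ on $\mathbb{R}^m$ and $g=\lambda\|\cdot\|_1$ on $\mathbb{R}^n$. Let $P(x)=f(Ax)+g(x)$ and $D(u)=-f^*(-u)-g^*(A^{\top}u)$. Then for every $u\in\mathrm{dom}(-D)$, $$\mathcal{B}(c_{\mathrm{SAFE}},r_{\mathrm{SAFE}})\supseteq\mathcal{B}_{\mathrm{RYU}}(0_n,u),$$ where $c_{\mathrm{SAFE}}=y$, $r_{\mathrm{SAFE}}=\|y-u\|_2$, and $0_n$ is the zero vector of $\mathbb{R}^n$.
   Context: $h^*(z^* )=\sup_z \langle z^*,z\rangle-h(z)$ denotes the convex conjugate of $h$, and $\mathrm{dom}(h)=\{z: h(z)<+\infty\}$. $\mathcal{B}(c,r)=\{v\in\mathbb{R}^m:\|v-c\|_2\le r\}$ for $r\ge 0$. For a problem in which $\nabla f$ is $\alpha^{-1}$-Lipschitz and $(x,u)\in\mathrm{dom}(P)\times\mathrm{dom}(-D)$, the RYU ball is $\mathcal{B}_{\mathrm{RYU}}(x,u)=\mathcal{B}(c_{\mathrm{RYU}},r_{\mathrm{RYU}})$ with $c_{\mathrm{RYU}}=\frac12(u-\nabla f(Ax))$ and $r_{\mathrm{RYU}}=\sqrt{\frac{P(x)-D(u)}{\alpha}-\frac{\|u+\nabla f(Ax)\|_2^2}{4}}$; the quantity under the square root is nonnegative. Here $f=\frac12\|y-\cdot\|_2^2$ and $\alpha=1$.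 *)

theory Defs
  imports "HOL-Analysis.Analysis"
begin

definition convex_conjugate :: "('a::real_inner \<Rightarrow> ereal) \<Rightarrow> 'a \<Rightarrow> ereal" where
  "convex_conjugate h s = (SUP z. ereal (s \<bullet> z) - h z)"

definition edom :: "('a \<Rightarrow> ereal) \<Rightarrow> 'a set" where
  "edom h = {z. h z < \<infinity>}"

(* Unspecified where f is not differentiable. *)
definition gradient :: "('a::real_inner \<Rightarrow> real) \<Rightarrow> 'a \<Rightarrow> 'a" where
  "gradient f z = (THE d. GDERIV f z :> d)"

definition l1_norm :: "real^'n \<Rightarrow> real" where
  "l1_norm x = (\<Sum>i\<in>UNIV. \<bar>x $ i\<bar>)"

(* The smooth term f is finite everywhere, hence real-valued; g may take the value \<infinity>. *)
definition primal :: "(real^'m \<Rightarrow> real) \<Rightarrow> (real^'n \<Rightarrow> ereal) \<Rightarrow> real^'n^'m \<Rightarrow> real^'n \<Rightarrow> ereal" where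
  "primal f g A x = ereal (f (A *v x)) + g x"

definition dual :: "(real^'m \<Rightarrow> real) \<Rightarrow> (real^'n \<Rightarrow> ereal) \<Rightarrow> real^'n^'m \<Rightarrow> real^'m \<Rightarrow> ereal" where
  "dual f g A u =
     - convex_conjugate (\<lambda>z. ereal (f z)) (- u) - convex_conjugate g (transpose A *v u)"

definition ryu_center :: "(real^'m \<Rightarrow> real) \<Rightarrow> real^'n^'m \<Rightarrow> real^'n \<Rightarrow> real^'m \<Rightarrow> real^'m" where
  "ryu_center f A x u = (1/2) *\<^sub>R (u - gradient f (A *v x))"

(* The duality gap is finite for x in dom P and u in dom (-D), the only pairs for which the
   ball is considered, so real_of_ereal loses nothing there. *)
definition ryu_radius ::
    "real \<Rightarrow> (real^'m \<Rightarrow> real) \<Rightarrow> (real^'n \<Rightarrow> ereal) \<Rightarrow> real^'n^'m \<Rightarrow> real^'n \<Rightarrow> real^'m \<Rightarrow> real" where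
  "ryu_radius \<alpha> f g A x u =
     sqrt (real_of_ereal (primal f g A x - dual f g A u) / \<alpha>
           - (norm (u + gradient f (A *v x)))\<^sup>2 / 4)"

definition ryu_ball ::
    "real \<Rightarrow> (real^'m \<Rightarrow> real) \<Rightarrow> (real^'n \<Rightarrow> ereal) \<Rightarrow> real^'n^'m \<Rightarrow> real^'n \<Rightarrow> real^'m \<Rightarrow> (real^'m) set" where
  "ryu_ball \<alpha> f g A x u = cball (ryu_center f A x u) (ryu_radius \<alpha> f g A x u)"

end

theory Submission
  imports Defs
begin

text \<open>The conjugate of the positively homogeneous function \<open>g\<close> is \<open>0\<close> wherever it is finite, and
  \<open>f\<^sup>* (- u) = \<parallel>u\<parallel>\<^sup>2 / 2 - \<langle>u, y\<rangle>\<close>, so for dual feasible \<open>u\<close> the duality gap at \<open>x = 0\<close> is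
  \<open>\<parallel>y - u\<parallel>\<^sup>2 / 2\<close>. Hence the RYU ball has center \<open>(u + y) / 2\<close> and radius \<open>\<parallel>y - u\<parallel> / 2\<close>, i.e. the
  segment from \<open>u\<close> to \<open>y\<close> is a diameter, and the ball lies inside the one centered at \<open>y\<close> through \<open>u\<close>.\<close>

text \<open>Derivatives are unique and a vector is determined by its inner products, so the
  description in \<open>gradient\<close> picks out \<open>d\<close>.\<close>

lemma gradient_eqI:
  assumes "GDERIV f z :> d"
  shows "gradient f z = d"
  unfolding gradient_def
proof (rule the_equality)
  fix e assume "GDERIV f z :> e"
  with assms have "(\<lambda>h. h \<bullet> e) = (\<lambda>h. h \<bullet> d)"
    unfolding gderiv_def by (metis has_derivative_unique)
  then show "e = d" by (metis vector_eq_ldot)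
qed (fact assms)

lemma gradient_half_norm_sq:
  fixes y z :: "'a::real_inner"
  shows "gradient (\<lambda>z. (1/2) * (norm (y - z))\<^sup>2) z = z - y"
  by (rule gradient_eqI)
     (auto simp: gderiv_def power2_norm_eq_inner inner_diff_right inner_commute algebra_simps
        intro!: derivative_eq_intros)

lemma convex_conjugate_half_norm_sq:
  fixes y s :: "'a::real_inner"
  shows "convex_conjugate (\<lambda>z. ereal ((1/2) * (norm (y - z))\<^sup>2)) s
    = ereal ((norm s)\<^sup>2 / 2 + s \<bullet> y)"
proof -
  have complete_square: "s \<bullet> z - (1/2) * (norm (y - z))\<^sup>2
      = (norm s)\<^sup>2 / 2 + s \<bullet> y - (norm (s + y - z))\<^sup>2 / 2" for z
    by (simp add: power2_norm_eq_inner inner_simps inner_commute field_simps)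
  show ?thesis
    unfolding convex_conjugate_def
  \<comment> \<open>The maximizer \<open>s + y\<close> is the point where the subtracted square
    vanishes.\<close>
  proof (rule antisym[OF SUP_least SUP_upper2[where i = "s + y"]])
    show "ereal (s \<bullet> z) - ereal ((1/2) * (norm (y - z))\<^sup>2) \<le> ereal ((norm s)\<^sup>2 / 2 + s \<bullet> y)" for z
      using complete_square[of z] by simp
    show "ereal ((norm s)\<^sup>2 / 2 + s \<bullet> y)
        \<le> ereal (s \<bullet> (s + y)) - ereal ((1/2) * (norm (y - (s + y)))\<^sup>2)"
      using complete_square[of "s + y"] by simp
  qed simp
qed

text \<open>A positive value of \<open>s \<bullet> z - h z\<close> would grow without bound along
  the ray through \<open>z\<close>; the origin contributes \<open>0\<close>.\<close>

lemma convex_conjugate_pos_homogeneous: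
  fixes h :: "'a::real_inner \<Rightarrow> real"
  assumes hom: "\<And>t x. t \<ge> 0 \<Longrightarrow> h (t *\<^sub>R x) = t * h x"
    and finite: "convex_conjugate (\<lambda>x. ereal (h x)) s < \<infinity>"
  shows "convex_conjugate (\<lambda>x. ereal (h x)) s = 0"
proof -
  let ?c = "convex_conjugate (\<lambda>x. ereal (h x)) s"
  have upper: "ereal (s \<bullet> z - h z) \<le> ?c" for z
    unfolding convex_conjugate_def by (rule SUP_upper2[of z]) auto
  have nonneg: "0 \<le> ?c"
    using upper[of 0] hom[of 0 0] by (simp add: zero_ereal_def)
  then obtain c where c: "?c = ereal c" and "0 \<le> c"
    using finite by (cases ?c) auto
  have "s \<bullet> z - h z \<le> 0" for z
  proof (rule ccontr)
    assume "\<not> s \<bullet> z - h z \<le> 0"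
    then have pos: "0 < s \<bullet> z - h z" by simp
    \<comment> \<open>Scaling \<open>z\<close> by this \<open>t\<close> yields the value
      \<open>c + 1\<close>, which exceeds the supremum \<open>c\<close>.\<close>
    define t where "t = (c + 1) / (s \<bullet> z - h z)"
    have "t \<ge> 0" using pos \<open>0 \<le> c\<close> by (simp add: t_def)
    then have "t * (s \<bullet> z - h z) \<le> c"
      using upper[of "t *\<^sub>R z"] by (simp add: c hom right_diff_distrib)
    then show False using pos by (simp add: t_def)
  qed
  then have "?c \<le> 0"
    unfolding convex_conjugate_def by (intro SUP_least) (simp add: zero_ereal_def)
  with nonneg show ?thesis by (rule antisym[rotated])
qed

lemma l1_norm_scaleR: "l1_norm (t *\<^sub>R x) = \<bar>t\<bar> * l1_norm x"
  by (simp add: l1_norm_def abs_mult sum_distrib_left)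

theorem proposition4p8:
  fixes A :: "real^'n^'m" and y :: "real^'m" and lam :: real
    and f :: "real^'m \<Rightarrow> real" and g :: "real^'n \<Rightarrow> ereal"
  assumes lam_pos: "lam > 0"
    and f_eq: "f = (\<lambda>z. (1/2) * (norm (y - z))\<^sup>2)"
    and g_eq: "g = (\<lambda>x. ereal (lam * l1_norm x))"
  shows "\<forall>u \<in> edom (\<lambda>u. - dual f g A u).
           cball y (norm (y - u)) \<supseteq> ryu_ball 1 f g A 0 u"
proof
  fix u assume u: "u \<in> edom (\<lambda>u. - dual f g A u)"
  have conj_f: "convex_conjugate (\<lambda>z. ereal (f z)) (- u) = ereal ((norm u)\<^sup>2 / 2 - u \<bullet> y)"
    unfolding f_eq convex_conjugate_half_norm_sq by simp
  have "convex_conjugate g (transpose A *v u) < \<infinity>"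
    \<comment> \<open>As the conjugate of \<open>f\<close> is finite at \<open>- u\<close>, an
      infinite conjugate of \<open>g\<close> would make \<open>- dual f g A u\<close>
      infinite.\<close>
    using u by (cases "convex_conjugate g (transpose A *v u)") (auto simp: edom_def dual_def conj_f)
  then have conj_g: "convex_conjugate g (transpose A *v u) = 0"
    unfolding g_eq by (intro convex_conjugate_pos_homogeneous) (simp_all add: l1_norm_scaleR)
  have gap: "primal f g A 0 - dual f g A u = ereal ((norm (y - u))\<^sup>2 / 2)"
    unfolding primal_def dual_def conj_f conj_g
    by (simp add: f_eq g_eq l1_norm_def power2_norm_eq_inner inner_simps inner_commute field_simps)
  have grad: "gradient f 0 = - y"
    unfolding f_eq gradient_half_norm_sq by simp
  have center: "ryu_center f A 0 u = (1/2) *\<^sub>R (u + y)"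
    by (simp add: ryu_center_def grad)
  \<comment> \<open>Half of the squared distance from the gap, minus a quarter from the gradient
    term, leaves a quarter.\<close>
  have "ryu_radius 1 f g A 0 u = sqrt ((norm (y - u) / 2)\<^sup>2)"
    by (simp add: ryu_radius_def grad gap norm_minus_commute power_divide)
  then have radius: "ryu_radius 1 f g A 0 u = norm (y - u) / 2"
    by simp
  have "y - (1/2) *\<^sub>R (u + y) = (1/2) *\<^sub>R (y - u)"
    by (simp add: algebra_simps flip: scaleR_add_left)
  then have "dist ((1/2) *\<^sub>R (u + y)) y = norm (y - u) / 2"
    by (simp add: dist_norm norm_minus_commute)
  \<comment> \<open>The distance of the centers plus the smaller radius equals the larger radius:
    the balls touch internally.\<close>
  then show "ryu_ball 1 f g A 0 u \<subseteq> cball y (norm (y - u))"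
    unfolding ryu_ball_def center radius by (simp add: cball_subset_cball_iff)
qed

end
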